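(* There are absolute constants $C,c>0$ such that the following holds. Let $G$ be a finite abelian group of order $n$ and let $\alpha\in(0,1)$. There exist collections $\mathcal{F}_\ell$ ($\ell=0,1,2,\dots$) of subsets of $G$ with \[|\mathcal{F}_\ell|\le\exp\left(C2^{2\ell}(\log n)^2\right)\quad\text{and}\quad\min_{F\in\mathcal{F}_\ell}|F|\ge c\,2^{\ell}\alpha n/\max(1,\ell)^2,\] such that: for every $K\ge1$ and every $A\subseteq G$ with $|A+A|\le K|A|$ and $|A|=\alpha n$, letting $\ell$ be the smallest integer $0\le\ell\le\log_2K$ with $|A^+_\ell|\ge c\,2^{\ell}\alpha n/\max(1,\ell)^2$ (such an integer exists), there is $F\in\mathcal{F}_\ell$ with $A+A\supseteq F\supseteq A^+_\ell$.
   Context: A set $A$ is identified with its indicator function, $A+A=\{a+b:a,b\in A\}$, and $f*g(x)=\frac1n\sum_{y\in G}f(y)g(x-y)$, so $A*A(x)=|\{(a,b)\in A^2:a+b=x\}|/n$. For an integer $\ell\ge0$, $A^+_\ell=\{x\in G: A*A(x)\in(2^{-\ell-1}\alpha,\,2^{-\ell}\alpha]\}$.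
   Formalization: The claim that such an ℓ exists is false for 0≤ℓ≤log₂K when K is not a power of 2; existence is proved for 0≤ℓ≤⌈log₂K⌉, with F for the smallest such ℓ. For the range ℓ≤log₂K, F is given for the smallest ℓ whenever one exists. *)

theory Defs
  imports Complex_Main "HOL-Algebra.Coset" "HOL-Library.Indicator_Function"
begin

text \<open>
  Groups are records of HOL-Algebra, written multiplicatively, so the sumset is
  \<open>A <#>\<^bsub>G\<^esub> A\<close> and \<open>x - y\<close> is \<open>x \<otimes>\<^bsub>G\<^esub> inv\<^bsub>G\<^esub> y\<close>. A group carried by a type class would put
  the quantification over the group outside that over the absolute constants. With the carrier
  inside an arbitrary type \<open>'a\<close> the constants precede the group, and the instance \<open>'a = nat\<close>
  already covers every finite abelian group up to isomorphism with one pair of constants.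
\<close>

definition convolution ::
  "('a, 'b) monoid_scheme \<Rightarrow> ('a \<Rightarrow> real) \<Rightarrow> ('a \<Rightarrow> real) \<Rightarrow> 'a \<Rightarrow> real" where
  "convolution G f g x =
     (1 / real (order G)) * (\<Sum>y\<in>carrier G. f y * g (x \<otimes>\<^bsub>G\<^esub> inv\<^bsub>G\<^esub> y))"

definition level_set :: "('a, 'b) monoid_scheme \<Rightarrow> real \<Rightarrow> 'a set \<Rightarrow> nat \<Rightarrow> 'a set" where
  "level_set G \<alpha> A l =
     {x \<in> carrier G. convolution G (indicator A) (indicator A) x \<in> {\<alpha> / 2 ^ (l + 1) <.. \<alpha> / 2 ^ l}}"

definition level_threshold :: "real \<Rightarrow> real \<Rightarrow> nat \<Rightarrow> nat \<Rightarrow> real" where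
  "level_threshold c \<alpha> n l = c * 2 ^ l * \<alpha> * real n / (max 1 (real l))\<^sup>2"

text \<open>
  \<open>popular_level G c \<alpha> A b l\<close>: the level \<open>l\<close> lies in the range \<open>0 \<le> l \<le> b\<close> and its level set is
  large. For \<open>b = log 2 K\<close> with \<open>log 2 K\<close> not an integer there may be no such level, whatever the
  value of \<open>c > 0\<close>: for \<open>K < 2\<close> only \<open>l = 0\<close> is in range, and there are sets of density slightly
  above \<open>1/2\<close> with \<open>A + A = G\<close> whose convolution is below \<open>\<alpha>/2\<close> outside a set of arbitrarily
  small density. Existence does hold for \<open>b = \<lceil>log 2 K\<rceil>\<close>, which is the same range when \<open>K\<close> is a
  power of two; a least level for \<open>b = log 2 K\<close> is also the least one for \<open>b = \<lceil>log 2 K\<rceil>\<close>.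
\<close>

definition popular_level ::
  "('a, 'b) monoid_scheme \<Rightarrow> real \<Rightarrow> real \<Rightarrow> 'a set \<Rightarrow> real \<Rightarrow> nat \<Rightarrow> bool" where
  "popular_level G c \<alpha> A b l \<longleftrightarrow>
     real l \<le> b \<and> real (card (level_set G \<alpha> A l)) \<ge> level_threshold c \<alpha> (order G) l"

end

theory Submission
  imports Defs "HOL-Algebra.Multiplicative_Group"
begin

text \<open>
  By Fourier inversion \<open>A * A\<close> is the sum of \<open>h(\<chi>)\<^sup>2 \<chi>\<close> over the characters, where \<open>h\<close> is the
  Fourier transform of \<open>A\<close>, and by Parseval the numbers \<open>|h(\<chi>)|\<^sup>2\<close> add up to \<open>\<alpha>\<close>. Hence
  \<open>A * A / (2 \<alpha>)\<close> is a convex combination of \<open>4 n\<close> bounded functions which do not depend on \<open>A\<close>.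
  Sampling \<open>O(4\<^sup>l log n)\<close> of them approximates it uniformly up to \<open>2\<^sup>-\<^sup>l\<^sup>-\<^sup>3\<close>, and \<open>F\<close> is a
  superlevel set of the sample mean: it contains the level set \<open>l\<close>, where \<open>A * A / (2 \<alpha>)\<close> exceeds
  \<open>2\<^sup>-\<^sup>l\<^sup>-\<^sup>2\<close>, and avoids the complement of the sumset, where \<open>A * A\<close> vanishes. The number of
  samples bounds the number of sets \<open>F\<close>. Some level is popular because otherwise the levels up to
  \<open>\<lceil>log 2 K\<rceil>\<close> and the remaining, at most \<open>K \<alpha> n\<close>, elements of the sumset carry less than the
  total mass \<open>\<alpha>\<^sup>2 n\<close> of \<open>A * A\<close>.
\<close>

section \<open>Uniform approximation by samples\<close>

lemma exp_le_quadratic: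
  fixes y :: real
  assumes "\<bar>y\<bar> \<le> 1"
  shows "exp y \<le> 1 + y + y\<^sup>2"
proof (cases "y \<ge> 0")
  case True
  then show ?thesis using exp_bound[of y] assms by simp
next
  case False
  define z where "z = - y"
  have z: "0 < z" "z \<le> 1" using False assms by (auto simp: z_def)
  \<comment> \<open>The identity shows that the claimed bound \<open>1 - z + z\<^sup>2\<close> is at
    least the reciprocal of \<open>1 + z\<close>, which in turn is at least
    \<open>exp (- z)\<close>.\<close>
  have "(1 + z) * (1 - z + z\<^sup>2) = 1 + z ^ 3"
    by (simp add: algebra_simps power2_eq_square power3_eq_cube)
  then have "1 \<le> (1 + z) * (1 - z + z\<^sup>2)" using z by simp
  also have "\<dots> \<le> exp z * (1 - z + z\<^sup>2)"
  proof (rule mult_right_mono)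
    show "1 + z \<le> exp z" by (rule exp_ge_add_one_self)
    show "0 \<le> 1 - z + z\<^sup>2" using z by (simp add: add_nonneg_nonneg)
  qed
  finally have "exp (- z) * 1 \<le> exp (- z) * (exp z * (1 - z + z\<^sup>2))"
    by (intro mult_left_mono) auto
  also have "\<dots> = 1 - z + z\<^sup>2"
    by (simp add: exp_minus)
  finally show ?thesis by (simp add: z_def)
qed

text \<open>The finite form of the first-moment method: it turns the random choice of an index into
  an actual one.\<close>

lemma exists_le_weighted_average:
  fixes p a :: "'i \<Rightarrow> real"
  assumes "finite I" and p: "\<And>i. i \<in> I \<Longrightarrow> 0 \<le> p i" and "sum p I = 1"
    and le: "(\<Sum>i\<in>I. p i * a i) \<le> B"
  shows "\<exists>i\<in>I. a i \<le> B"
proof (rule ccontr)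
  assume "\<not> ?thesis"
  then have gt: "B < a i" if "i \<in> I" for i using that by force
  obtain j where j: "j \<in> I" "p j > 0"
    using assms by (metis less_eq_real_def sum.neutral zero_neq_one)
  have "0 < (\<Sum>i\<in>I. p i * (a i - B))"
    using j gt p by (intro sum_pos2[OF \<open>finite I\<close> j(1)]) (auto simp: less_imp_le)
  also have "\<dots> = (\<Sum>i\<in>I. p i * a i) - B"
    using \<open>sum p I = 1\<close> by (simp add: right_diff_distrib sum_subtractf flip: sum_distrib_right)
  finally show False using le by simp
qed

text \<open>After centring, the linear term of the quadratic bound averages to zero. The deviations
  are at most 2 in modulus, so \<open>t \<le> 1/2\<close> keeps the exponent in the range of
  \<open>exp_le_quadratic\<close>, and the quadratic term is at most
  \<open>4 * t\<^sup>2\<close>.\<close>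

lemma exp_moment_le:
  fixes p a :: "'i \<Rightarrow> real"
  assumes "finite I" and p: "\<And>i. i \<in> I \<Longrightarrow> 0 \<le> p i" and p1: "sum p I = 1"
    and a: "\<And>i. i \<in> I \<Longrightarrow> \<bar>a i\<bar> \<le> 1" and t: "0 \<le> t" "t \<le> 1/2"
  shows "(\<Sum>i\<in>I. p i * exp (t * (a i - (\<Sum>j\<in>I. p j * a j)))) \<le> exp (4 * t\<^sup>2)"
proof -
  define \<mu> where "\<mu> = (\<Sum>j\<in>I. p j * a j)"
  have "\<bar>\<mu>\<bar> \<le> (\<Sum>j\<in>I. p j * \<bar>a j\<bar>)"
    unfolding \<mu>_def using p by (intro order.trans[OF sum_abs]) (auto simp: abs_mult intro!: sum_mono)
  also have "\<dots> \<le> (\<Sum>j\<in>I. p j * 1)"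
    using p a by (intro sum_mono mult_left_mono) auto
  finally have \<mu>: "\<bar>\<mu>\<bar> \<le> 1" using p1 by simp
  have "(\<Sum>i\<in>I. p i * exp (t * (a i - \<mu>))) \<le> (\<Sum>i\<in>I. p i * (1 + t * (a i - \<mu>) + 4 * t\<^sup>2))"
  proof (intro sum_mono mult_left_mono)
    fix i assume i: "i \<in> I"
    have d: "\<bar>a i - \<mu>\<bar> \<le> 2" using a[OF i] \<mu> by linarith
    have "\<bar>t * (a i - \<mu>)\<bar> \<le> 1/2 * 2"
      unfolding abs_mult using t d by (intro mult_mono) auto
    then have "exp (t * (a i - \<mu>)) \<le> 1 + t * (a i - \<mu>) + (t * (a i - \<mu>))\<^sup>2"
      by (intro exp_le_quadratic) auto
    also have "(t * (a i - \<mu>))\<^sup>2 \<le> t\<^sup>2 * 2\<^sup>2"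
      unfolding power_mult_distrib using d abs_le_square_iff[of "a i - \<mu>" 2] by (intro mult_left_mono) auto
    finally show "exp (t * (a i - \<mu>)) \<le> 1 + t * (a i - \<mu>) + 4 * t\<^sup>2" by simp
  qed (use p in auto)
  also have "\<dots> = (\<Sum>i\<in>I. (1 - t * \<mu> + 4 * t\<^sup>2) * p i + t * (p i * a i))"
    by (intro sum.cong) (auto simp: algebra_simps)
  also have "\<dots> = (1 - t * \<mu> + 4 * t\<^sup>2) * sum p I + t * \<mu>"
    by (simp add: sum.distrib \<mu>_def sum_distrib_left)
  also have "\<dots> = 1 + 4 * t\<^sup>2" using p1 by simp
  also have "\<dots> \<le> exp (4 * t\<^sup>2)" by (rule exp_ge_add_one_self)
  finally show ?thesis by (simp add: \<mu>_def)
qed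

text \<open>Hoeffding's bound, derandomised: each new index keeps the exponential moment below its average.\<close>

lemma exists_sample_exp_moment:
  fixes p :: "'i \<Rightarrow> real" and g :: "'i \<Rightarrow> 'x \<Rightarrow> real"
  assumes I: "finite I" and p: "\<And>i. i \<in> I \<Longrightarrow> 0 \<le> p i" and p1: "sum p I = 1"
    and g: "\<And>i x. i \<in> I \<Longrightarrow> x \<in> X \<Longrightarrow> \<bar>g i x\<bar> \<le> 1" and t: "0 \<le> t" "t \<le> 1/2"
  shows "\<exists>s. set s \<subseteq> I \<and> length s = m \<and>
    (\<Sum>x\<in>X. exp (t * (\<Sum>i\<leftarrow>s. g i x - (\<Sum>j\<in>I. p j * g j x)))) \<le> real (card X) * exp (4 * t\<^sup>2) ^ m"
proof (induction m)
  case 0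
  show ?case by simp
next
  case (Suc m)
  define f where "f x = (\<Sum>j\<in>I. p j * g j x)" for x
  define \<Phi> where "\<Phi> s x = exp (t * (\<Sum>i\<leftarrow>s. g i x - f x))" for s x
  from Suc obtain s where s: "set s \<subseteq> I" "length s = m"
    and le: "(\<Sum>x\<in>X. \<Phi> s x) \<le> real (card X) * exp (4 * t\<^sup>2) ^ m"
    unfolding f_def \<Phi>_def by blast
  \<comment> \<open>At each \<open>x\<close> the factor \<open>\<Phi> s x\<close> of the old sample
    does not depend on the new index, so the average over \<open>i\<close> acts on the new factor
    alone.\<close>
  have "(\<Sum>i\<in>I. p i * (\<Sum>x\<in>X. \<Phi> (i # s) x))
      = (\<Sum>x\<in>X. \<Phi> s x * (\<Sum>i\<in>I. p i * exp (t * (g i x - f x))))"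
    unfolding sum_distrib_left
    by (subst sum.swap) (simp add: \<Phi>_def distrib_left exp_add mult_ac)
  also have "\<dots> \<le> (\<Sum>x\<in>X. \<Phi> s x * exp (4 * t\<^sup>2))"
    unfolding f_def using assms
    by (intro sum_mono mult_left_mono exp_moment_le) (auto simp: \<Phi>_def)
  also have "\<dots> = exp (4 * t\<^sup>2) * (\<Sum>x\<in>X. \<Phi> s x)"
    by (simp add: mult.commute flip: sum_distrib_right)
  also have "\<dots> \<le> exp (4 * t\<^sup>2) * (real (card X) * exp (4 * t\<^sup>2) ^ m)"
    using le by (intro mult_left_mono) auto
  finally obtain i where "i \<in> I"
    "(\<Sum>x\<in>X. \<Phi> (i # s) x) \<le> exp (4 * t\<^sup>2) * (real (card X) * exp (4 * t\<^sup>2) ^ m)"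
    using exists_le_weighted_average[OF I, of p "\<lambda>i. \<Sum>x\<in>X. \<Phi> (i # s) x"] p p1 by blast
  with s show ?case
    by (intro exI[of _ "i # s"]) (simp add: \<Phi>_def f_def mult_ac)
qed

text \<open>Chernoff's argument. The exponential moments are positive, so their sum over
  \<open>X\<close> bounds each one of them, and a single sample serves all points at once at the
  price of \<open>ln (card X)\<close>.\<close>

lemma exists_sample_upper:
  fixes p :: "'i \<Rightarrow> real" and g :: "'i \<Rightarrow> 'x \<Rightarrow> real"
  assumes I: "finite I" and p: "\<And>i. i \<in> I \<Longrightarrow> 0 \<le> p i" and p1: "sum p I = 1"
    and g: "\<And>i x. i \<in> I \<Longrightarrow> x \<in> X \<Longrightarrow> \<bar>g i x\<bar> \<le> 1"
    and X: "finite X" and eps: "0 < e" "e \<le> 4"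
    and m: "16 * ln (real (card X)) / e\<^sup>2 \<le> real m"
  shows "\<exists>s. set s \<subseteq> I \<and> length s = m \<and>
    (\<forall>x\<in>X. (\<Sum>i\<leftarrow>s. g i x) \<le> real m * (\<Sum>j\<in>I. p j * g j x) + e * real m)"
proof -
  \<comment> \<open>With this choice \<open>4 * m * t\<^sup>2\<close> equals
    \<open>e\<^sup>2 * m / 16\<close>, which by the hypothesis on \<open>m\<close> also bounds
    \<open>ln (card X)\<close>; the two together give exactly \<open>t * e * m\<close>. The
    condition \<open>e \<le> 4\<close> becomes \<open>t \<le> 1/2\<close>.\<close>
  define t where "t = e / 8"
  have t: "0 < t" "t \<le> 1/2" using eps by (auto simp: t_def)
  obtain s where s: "set s \<subseteq> I" "length s = m"
    and le: "(\<Sum>x\<in>X. exp (t * (\<Sum>i\<leftarrow>s. g i x - (\<Sum>j\<in>I. p j * g j x))))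
      \<le> real (card X) * exp (4 * t\<^sup>2) ^ m"
    using exists_sample_exp_moment[OF I p p1, of X g t m] g t by auto
  have "(\<Sum>i\<leftarrow>s. g i x) \<le> real m * (\<Sum>j\<in>I. p j * g j x) + e * real m" if x: "x \<in> X" for x
  proof -
    define D where "D = (\<Sum>i\<leftarrow>s. g i x - (\<Sum>j\<in>I. p j * g j x))"
    have D: "D = (\<Sum>i\<leftarrow>s. g i x) - real m * (\<Sum>j\<in>I. p j * g j x)"
      using s by (simp add: D_def sum_list_subtractf sum_list_triv)
    have card: "0 < real (card X)" using X x by (auto simp: card_gt_0_iff)
    have "exp (t * D) \<le> (\<Sum>x\<in>X. exp (t * (\<Sum>i\<leftarrow>s. g i x - (\<Sum>j\<in>I. p j * g j x))))"
      unfolding D_def using X x by (intro member_le_sum) auto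
    also have "\<dots> \<le> real (card X) * exp (4 * t\<^sup>2) ^ m" by (rule le)
    also have "\<dots> = exp (ln (real (card X)) + real m * (4 * t\<^sup>2))"
      using card by (simp add: exp_add exp_of_nat_mult)
    finally have "t * D \<le> ln (real (card X)) + real m * (4 * t\<^sup>2)" by simp
    also have "\<dots> \<le> e\<^sup>2 * real m / 16 + real m * (4 * t\<^sup>2)"
      using m eps by (simp add: field_simps)
    also have "\<dots> = t * (e * real m)"
      by (simp add: t_def power2_eq_square)
    finally show ?thesis using t D by (simp add: mult_le_cancel_left_pos)
  qed
  with s show ?thesis by blast
qed

text \<open>Lower deviations of \<open>g\<close> are upper deviations of its negative. Applying the
  one-sided bound to points with a sign makes one sample good for both directions, and the doubled
  number of points is the factor 2 in the logarithm.\<close>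

lemma exists_sample_uniform:
  fixes p :: "'i \<Rightarrow> real" and g :: "'i \<Rightarrow> 'x \<Rightarrow> real"
  assumes I: "finite I" and p: "\<And>i. i \<in> I \<Longrightarrow> 0 \<le> p i" and p1: "sum p I = 1"
    and g: "\<And>i x. i \<in> I \<Longrightarrow> x \<in> X \<Longrightarrow> \<bar>g i x\<bar> \<le> 1"
    and X: "finite X" and eps: "0 < e" "e \<le> 4"
    and m: "16 * ln (2 * real (card X)) / e\<^sup>2 \<le> real m"
  shows "\<exists>s. set s \<subseteq> I \<and> length s = m \<and>
    (\<forall>x\<in>X. \<bar>(\<Sum>i\<leftarrow>s. g i x) - real m * (\<Sum>j\<in>I. p j * g j x)\<bar> \<le> e * real m)"
proof -
  define g' where "g' i y = snd y * g i (fst y)" for i and y :: "'x \<times> real"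
  define X' where "X' = X \<times> {1, -1 :: real}"
  have "card X' = 2 * card X" by (simp add: X'_def card_cartesian_product)
  then have m': "16 * ln (real (card X')) / e\<^sup>2 \<le> real m" using m by simp
  have "\<bar>g' i y\<bar> \<le> 1" if "i \<in> I" "y \<in> X'" for i y
    using that g by (auto simp: g'_def X'_def)
  then obtain s where s: "set s \<subseteq> I" "length s = m" and
    le: "\<And>y. y \<in> X' \<Longrightarrow> (\<Sum>i\<leftarrow>s. g' i y) \<le> real m * (\<Sum>j\<in>I. p j * g' j y) + e * real m"
    using exists_sample_upper[OF I p p1, of X' g' e m] X eps m' by (force simp: X'_def)
  have "\<bar>(\<Sum>i\<leftarrow>s. g i x) - real m * (\<Sum>j\<in>I. p j * g j x)\<bar> \<le> e * real m" if "x \<in> X" for x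
  proof -
    have "(\<Sum>i\<leftarrow>s. g' i (x, -1)) = - (\<Sum>i\<leftarrow>s. g i x)"
      by (simp add: g'_def uminus_sum_list_map o_def)
    then show ?thesis
      using le[of "(x, 1)"] le[of "(x, -1)"] that by (simp add: g'_def X'_def sum_negf abs_le_iff)
  qed
  with s show ?thesis by blast
qed

section \<open>Characters of finite abelian groups\<close>

text \<open>The domain \<open>H\<close> is a parameter because characters are built by extension
  from a subgroup to a larger one; values outside \<open>H\<close> are left arbitrary.\<close>

definition character_on :: "('a, 'b) monoid_scheme \<Rightarrow> 'a set \<Rightarrow> ('a \<Rightarrow> complex) \<Rightarrow> bool" where
  "character_on G H \<chi> \<longleftrightarrow>
     (\<forall>x\<in>H. norm (\<chi> x) = 1) \<and> (\<forall>x\<in>H. \<forall>y\<in>H. \<chi> (x \<otimes>\<^bsub>G\<^esub> y) = \<chi> x * \<chi> y)"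

text \<open>Extensionality fixes the values off the carrier, so that distinct characters differ on
  the group and can be counted.\<close>

definition characters :: "('a, 'b) monoid_scheme \<Rightarrow> ('a \<Rightarrow> complex) set" where
  "characters G = {\<chi> \<in> extensional (carrier G). character_on G (carrier G) \<chi>}"

lemma character_on_norm: "character_on G H \<chi> \<Longrightarrow> x \<in> H \<Longrightarrow> norm (\<chi> x) = 1"
  by (simp add: character_on_def)

lemma character_on_mult:
  "character_on G H \<chi> \<Longrightarrow> x \<in> H \<Longrightarrow> y \<in> H \<Longrightarrow> \<chi> (x \<otimes>\<^bsub>G\<^esub> y) = \<chi> x * \<chi> y"
  by (simp add: character_on_def)

lemma charactersD: "\<chi> \<in> characters G \<Longrightarrow> character_on G (carrier G) \<chi>"
  by (simp add: characters_def)

lemma complex_root_exists: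
  fixes z :: complex
  assumes "norm z = 1" "k > 0"
  shows "\<exists>w. w ^ k = z"
proof
  have "cis (Arg z / real k) ^ k = cis (Arg z)"
    using assms by (simp add: DeMoivre)
  also have "\<dots> = z"
    using assms cis_Arg[of z] norm_zero by (metis div_by_1 of_real_1 sgn_eq zero_neq_one)
  finally show "cis (Arg z / real k) ^ k = z" .
qed

lemma nontrivial_root_of_unity_exists:
  assumes "k > 1"
  shows "\<exists>w::complex. w ^ k = 1 \<and> w \<noteq> 1"
proof (rule ccontr)
  assume "\<not> ?thesis"
  then have "{z::complex. z ^ k = 1} \<subseteq> {1}" by auto
  then have "card {z::complex. z ^ k = 1} \<le> card {1::complex}" by (intro card_mono) auto
  with card_roots_unity_eq[of k] assms show False by simp
qed

context comm_group
begin

lemma subgroup_nat_pow_closed: "subgroup H G \<Longrightarrow> x \<in> H \<Longrightarrow> x [^] (k::nat) \<in> H"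
  by (induction k) (auto simp: subgroup.one_closed subgroup.m_closed)

lemma character_on_one:
  assumes "subgroup H G" "character_on G H \<chi>"
  shows "\<chi> \<one> = 1"
proof -
  have one: "\<one> \<in> H" using assms(1) by (rule subgroup.one_closed)
  have "\<chi> \<one> * \<chi> \<one> = \<chi> \<one>" using character_on_mult[OF assms(2) one one] by simp
  moreover have "\<chi> \<one> \<noteq> 0" using character_on_norm[OF assms(2) one] by auto
  ultimately show ?thesis by simp
qed

lemma character_on_pow:
  assumes "subgroup H G" "character_on G H \<chi>" "x \<in> H"
  shows "\<chi> (x [^] (k::nat)) = \<chi> x ^ k"
  by (induction k)
    (use assms in \<open>simp_all add: character_on_one character_on_mult subgroup_nat_pow_closed mult.commute\<close>)

lemma character_on_inv:
  assumes "subgroup H G" "character_on G H \<chi>" "x \<in> H"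
  shows "\<chi> (inv x) = cnj (\<chi> x)"
proof -
  have i: "inv x \<in> H" using assms by (simp add: subgroup.m_inv_closed)
  have "x \<in> carrier G" using assms by (simp add: subgroup.mem_carrier)
  then have "\<chi> x * \<chi> (inv x) = 1"
    using character_on_mult[OF assms(2,3) i] assms by (simp add: character_on_one)
  moreover have "\<chi> x * cnj (\<chi> x) = 1"
    using character_on_norm[OF assms(2,3)] by (simp add: complex_norm_square[symmetric])
  ultimately show ?thesis by (metis mult_left_cancel mult_zero_left zero_neq_one)
qed

text \<open>The number \<open>k\<close> is the order of \<open>g\<close> modulo \<open>H\<close>.
  The value \<open>w\<close> at \<open>g\<close> is constrained only by its \<open>k\<close>-th
  power, and each admissible \<open>w\<close> gives an extension sending
  \<open>h \<otimes> g [^] i\<close> to \<open>\<chi> h * w ^ i\<close>. The choice of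
  \<open>w\<close> is left open since separating points needs one with \<open>w \<noteq> 1\<close>,
  while enlarging a subgroup works with any.\<close>

lemma character_on_extend:
  assumes fin: "finite (carrier G)" and H: "subgroup H G" and chi: "character_on G H \<chi>"
    and g: "g \<in> carrier G" "g \<notin> H"
  shows "\<exists>k::nat. k > 1 \<and> g [^] k \<in> H \<and>
    (\<forall>w. w ^ k = \<chi> (g [^] k) \<longrightarrow>
      (\<exists>H' \<chi>'. subgroup H' G \<and> H \<subseteq> H' \<and> g \<in> H' \<and> character_on G H' \<chi>' \<and>
        (\<forall>h\<in>H. \<chi>' h = \<chi> h) \<and> \<chi>' g = w))"
proof -
  interpret H: subgroup H G by (rule H)
  define k where "k = (LEAST k::nat. k > 0 \<and> g [^] k \<in> H)"
  have ordpos: "order G > 0" using fin by (simp add: order_gt_0_iff_finite)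
  have "order G > 0 \<and> g [^] order G \<in> H"
    using g fin ordpos by (simp add: pow_order_eq_1)
  then have k: "k > 0" "g [^] k \<in> H"
    unfolding k_def by (rule LeastI2, simp)+
  have kmin: "\<not> (0 < j \<and> g [^] j \<in> H)" if "j < k" for j :: nat
    using not_less_Least[OF that[unfolded k_def]] .
  have "k \<noteq> 1" using k(2) g by (auto simp: nat_pow_eone)
  with k have k1: "k > 1" by simp
  \<comment> \<open>Division with remainder: the power of \<open>g\<close> to the remainder lies in
    \<open>H\<close> as well, so minimality of \<open>k\<close> forces the remainder to be
    0.\<close>
  have kdvd: "k dvd i" if i: "g [^] i \<in> H" for i :: nat
  proof -
    let ?a = "(g [^] k) [^] (i div k)"
    have a: "?a \<in> H" by (rule subgroup_nat_pow_closed[OF H k(2)])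
    have "?a \<otimes> g [^] (i mod k) = g [^] (k * (i div k) + i mod k)"
      using g(1) by (simp only: nat_pow_pow nat_pow_mult)
    also have "\<dots> = g [^] i" by simp
    finally have "g [^] (i mod k) = inv ?a \<otimes> g [^] i"
      using g(1) by (intro inv_solve_left[THEN iffD2]) auto
    then have "g [^] (i mod k) \<in> H" using a i by simp
    then have "i mod k = 0" using kmin[of "i mod k"] k by auto
    then show ?thesis by auto
  qed
  have "\<exists>H' \<chi>'. subgroup H' G \<and> H \<subseteq> H' \<and> g \<in> H' \<and> character_on G H' \<chi>' \<and>
        (\<forall>h\<in>H. \<chi>' h = \<chi> h) \<and> \<chi>' g = w" if w: "w ^ k = \<chi> (g [^] k)" for w
  proof -
    have "norm w ^ k = 1"
      using character_on_norm[OF chi k(2)] w by (simp flip: norm_power)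
    then have normw: "norm w = 1"
      using k power_eq_imp_eq_base[of "norm w" k 1] by simp
    define H' where "H' = {h \<otimes> g [^] (i::nat) | h i. h \<in> H}"
    \<comment> \<open>Well-definedness of the extension: cancelling \<open>g [^] j\<close> puts
      \<open>g [^] (i - j)\<close> into \<open>H\<close>, so \<open>i - j\<close> is a multiple of
      \<open>k\<close> and \<open>w ^ (i - j)\<close> is the value of \<open>\<chi>\<close>
      there.\<close>
    have wd': "\<chi> h * w ^ i = \<chi> h' * w ^ j"
      if hh: "h \<in> H" "h' \<in> H" and eq: "h \<otimes> g [^] i = h' \<otimes> g [^] j" and "j \<le> i"
      for h h' and i j :: nat
    proof -
      have "g [^] i = g [^] (i - j) \<otimes> g [^] j"
        using g \<open>j \<le> i\<close> by (simp add: nat_pow_mult)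
      with eq have "h \<otimes> g [^] (i - j) \<otimes> g [^] j = h' \<otimes> g [^] j"
        using g hh by (simp add: m_assoc)
      then have e: "h \<otimes> g [^] (i - j) = h'"
        using g hh by (subst (asm) right_cancel) auto
      then have "g [^] (i - j) = inv h \<otimes> h'"
        using g hh by (intro inv_solve_left[THEN iffD2]) auto
      then have gH: "g [^] (i - j) \<in> H" using hh by simp
      then obtain q where q: "i - j = k * q" using kdvd by (auto elim: dvdE)
      have "w ^ (i - j) = \<chi> (g [^] (i - j))"
        unfolding q power_mult w using character_on_pow[OF H chi k(2), of q] g
        by (simp add: nat_pow_pow)
      then have "\<chi> h * w ^ (i - j) = \<chi> h'"
        using character_on_mult[OF chi hh(1) gH] e by simp
      then have "\<chi> h * (w ^ (i - j) * w ^ j) = \<chi> h' * w ^ j" by simp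
      then show ?thesis using \<open>j \<le> i\<close> by (simp flip: power_add)
    qed
    have wd: "\<chi> h * w ^ i = \<chi> h' * w ^ j"
      if "h \<in> H" "h' \<in> H" "h \<otimes> g [^] i = h' \<otimes> g [^] j" for h h' and i j :: nat
      using wd'[of h h' i j] wd'[of h' h j i] that by (metis nat_le_linear)
    define \<chi>' where "\<chi>' y = (THE v. \<exists>h\<in>H. \<exists>i::nat. y = h \<otimes> g [^] i \<and> v = \<chi> h * w ^ i)" for y
    have chi': "\<chi>' (h \<otimes> g [^] i) = \<chi> h * w ^ i" if "h \<in> H" for h and i :: nat
      unfolding \<chi>'_def
    proof (rule the_equality)
      show "\<exists>h'\<in>H. \<exists>j::nat. h \<otimes> g [^] i = h' \<otimes> g [^] j \<and> \<chi> h * w ^ i = \<chi> h' * w ^ j"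
        using that by (intro bexI[of _ h] exI[of _ i]) simp_all
    next
      fix v assume "\<exists>h'\<in>H. \<exists>j::nat. h \<otimes> g [^] i = h' \<otimes> g [^] j \<and> v = \<chi> h' * w ^ j"
      then obtain h' and j :: nat
        where "h' \<in> H" "h \<otimes> g [^] i = h' \<otimes> g [^] j" "v = \<chi> h' * w ^ j" by blast
      then show "v = \<chi> h * w ^ i" using wd[OF that] by simp
    qed
    have mult: "(h \<otimes> g [^] i) \<otimes> (h' \<otimes> g [^] j) = (h \<otimes> h') \<otimes> g [^] (i + j)"
      if "h \<in> H" "h' \<in> H" for h h' and i j :: nat
      using that g by (simp add: m_ac flip: nat_pow_mult)
    have sub: "subgroup H' G"
    proof (rule subgroupI)
      show "H' \<subseteq> carrier G" using g by (auto simp: H'_def)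
      show "H' \<noteq> {}" unfolding H'_def using H.one_closed by blast
      show "x \<otimes> y \<in> H'" if "x \<in> H'" "y \<in> H'" for x y
      proof -
        obtain h h' and i j :: nat
          where h: "h \<in> H" "x = h \<otimes> g [^] i" "h' \<in> H" "y = h' \<otimes> g [^] j"
          using \<open>x \<in> H'\<close> \<open>y \<in> H'\<close> unfolding H'_def by blast
        then have "x \<otimes> y = (h \<otimes> h') \<otimes> g [^] (i + j)" using mult by simp
        then show ?thesis unfolding H'_def using h H.m_closed by blast
      qed
      show "inv x \<in> H'" if x: "x \<in> H'" for x
      proof -
        obtain h and i :: nat where h: "h \<in> H" "x = h \<otimes> g [^] i"
          using x by (auto simp: H'_def)
        \<comment> \<open>\<open>H'\<close> is built from nonnegative exponents only. Since
          \<open>g [^] order G\<close> is the unit, the inverse of \<open>g [^] i\<close> is still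
          such a power.\<close>
        have "i * (order G - 1) + i = order G * i"
          using ordpos by (cases "order G") auto
        then have "g [^] (i * (order G - 1)) \<otimes> g [^] i = (g [^] order G) [^] i"
          using g by (simp only: nat_pow_mult nat_pow_pow)
        then have "g [^] (i * (order G - 1)) \<otimes> g [^] i = \<one>"
          using g fin by (simp add: pow_order_eq_1)
        then have "inv (g [^] i) = g [^] (i * (order G - 1))"
          using g by (intro inv_equality) auto
        then have "inv x = inv h \<otimes> g [^] (i * (order G - 1))"
          using h g by (simp add: inv_mult)
        then show ?thesis using h unfolding H'_def by blast
      qed
    qed
    have HH': "h \<in> H' \<and> \<chi>' h = \<chi> h" if "h \<in> H" for h
    proof -
      have "h = h \<otimes> g [^] (0::nat)" using that by simp
      then have "h \<in> H'" unfolding H'_def using that by blast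
      then show ?thesis using chi'[OF that, of 0] that by simp
    qed
    have "g = \<one> \<otimes> g [^] (1::nat)" using g by simp
    then have gH': "g \<in> H'" unfolding H'_def using H.one_closed by blast
    have "\<chi>' g = w"
      using chi'[OF H.one_closed, of 1] g character_on_one[OF H chi] by simp
    moreover have "character_on G H' \<chi>'"
      unfolding character_on_def
    proof safe
      fix x assume "x \<in> H'"
      then obtain h and i :: nat where h: "h \<in> H" "x = h \<otimes> g [^] i"
        by (auto simp: H'_def)
      show "norm (\<chi>' x) = 1"
        using h chi'[OF h(1)] character_on_norm[OF chi h(1)] normw
        by (simp add: norm_mult norm_power)
      fix y assume "y \<in> H'"
      then obtain h' and j :: nat where h': "h' \<in> H" "y = h' \<otimes> g [^] j"
        by (auto simp: H'_def)
      show "\<chi>' (x \<otimes> y) = \<chi>' x * \<chi>' y"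
        using h h' by (simp add: mult chi' character_on_mult[OF chi] power_add)
    qed
    ultimately show ?thesis using sub gH' HH' by blast
  qed
  with k k1 show ?thesis by blast
qed

text \<open>Among the subgroups containing \<open>x\<close> that carry a character different from 1
  at \<open>x\<close>, one of largest cardinality is the whole group, as a proper one could be
  enlarged by \<open>character_on_extend\<close>. The first such subgroup arises by extending the
  trivial character of the trivial subgroup, where the value at \<open>x\<close> may be any
  \<open>k\<close>-th root of unity with \<open>k > 1\<close>.\<close>

lemma character_separates:
  assumes fin: "finite (carrier G)" and x: "x \<in> carrier G" "x \<noteq> \<one>"
  shows "\<exists>\<chi>\<in>characters G. \<chi> x \<noteq> 1"
proof -
  define P where "P H \<longleftrightarrow> subgroup H G \<and> x \<in> H \<and> (\<exists>\<chi>. character_on G H \<chi> \<and> \<chi> x \<noteq> 1)" for H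
  have triv: "subgroup {\<one>} G" by (rule triv_subgroup)
  have "character_on G {\<one>} (\<lambda>_. 1)" by (simp add: character_on_def)
  from character_on_extend[OF fin triv this x(1)] x(2)
  obtain k :: nat where k: "k > 1"
    and ext: "\<And>w::complex. w ^ k = 1 \<Longrightarrow>
      \<exists>H' \<chi>'. subgroup H' G \<and> x \<in> H' \<and> character_on G H' \<chi>' \<and> \<chi>' x = w"
    by (auto, metis)
  have ex: "\<exists>H. P H"
    using nontrivial_root_of_unity_exists[OF k] ext unfolding P_def by metis
  have bound: "card H < Suc (card (carrier G))" if "P H" for H
    using that fin by (auto simp: P_def less_Suc_eq_le intro!: card_mono subgroup.subset)
  obtain H where PH: "P H" and max: "\<And>H'. P H' \<Longrightarrow> card H' \<le> card H"
    using ex_has_greatest_nat[of P _ card "Suc (card (carrier G))"] ex bound by (metis less_imp_le)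
  then obtain \<chi> where H: "subgroup H G" "x \<in> H" and chi: "character_on G H \<chi>" "\<chi> x \<noteq> 1"
    by (auto simp: P_def)
  have "H = carrier G"
  proof (rule ccontr)
    assume "H \<noteq> carrier G"
    then obtain g where g: "g \<in> carrier G" "g \<notin> H" using subgroup.subset[OF H(1)] by blast
    from character_on_extend[OF fin H(1) chi(1) g] obtain k :: nat where k: "k > 1" "g [^] k \<in> H"
      and ext: "\<And>w. w ^ k = \<chi> (g [^] k) \<Longrightarrow>
        \<exists>H' \<chi>'. subgroup H' G \<and> H \<subseteq> H' \<and> g \<in> H' \<and> character_on G H' \<chi>' \<and> (\<forall>h\<in>H. \<chi>' h = \<chi> h)"
      by blast
    obtain w where "w ^ k = \<chi> (g [^] k)"
      using complex_root_exists[of "\<chi> (g [^] k)" k] character_on_norm[OF chi(1) k(2)] k by auto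
    from ext[OF this] obtain H' \<chi>' where H': "subgroup H' G" "H \<subseteq> H'" "g \<in> H'"
      "character_on G H' \<chi>'" "\<forall>h\<in>H. \<chi>' h = \<chi> h" by blast
    then have "P H'" using H chi unfolding P_def by (metis subsetD)
    moreover have "card H < card H'"
      using H' g fin by (intro psubset_card_mono finite_subset[OF subgroup.subset[OF H'(1)]]) auto
    ultimately show False using max by fastforce
  qed
  then have "restrict \<chi> (carrier G) \<in> characters G"
    using chi by (auto simp: characters_def character_on_def)
  then show ?thesis using chi x by (intro bexI[of _ "restrict \<chi> (carrier G)"]) auto
qed

section \<open>Orthogonality relations and the number of characters\<close>

lemma finite_characters:
  assumes "finite (carrier G)"
  shows "finite (characters G)"
proof (rule finite_subset)
  have ordpos: "order G > 0" using assms by (simp add: order_gt_0_iff_finite)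
  show "characters G \<subseteq> carrier G \<rightarrow>\<^sub>E {z. z ^ order G = 1}"
  proof
    fix \<chi> assume chi: "\<chi> \<in> characters G"
    have "\<chi> x ^ order G = 1" if "x \<in> carrier G" for x
      using character_on_pow[OF subgroup_self charactersD[OF chi] that, of "order G"]
        character_on_one[OF subgroup_self charactersD[OF chi]] assms that
      by (simp add: pow_order_eq_1)
    with chi show "\<chi> \<in> carrier G \<rightarrow>\<^sub>E {z. z ^ order G = 1}"
      by (auto simp: characters_def PiE_def)
  qed
  show "finite (carrier G \<rightarrow>\<^sub>E {z::complex. z ^ order G = 1})"
    using assms ordpos by (intro finite_PiE finite_roots_unity) auto
qed

text \<open>Multiplication by a character \<open>\<psi>\<close> with
  \<open>\<psi> x \<noteq> 1\<close> permutes the characters and multiplies the sum by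
  \<open>\<psi> x\<close>.\<close>

lemma sum_characters_nonunit:
  assumes fin: "finite (carrier G)" and x: "x \<in> carrier G" "x \<noteq> \<one>"
  shows "(\<Sum>\<chi>\<in>characters G. \<chi> x) = 0"
proof -
  obtain \<psi> where psi: "\<psi> \<in> characters G" "\<psi> x \<noteq> 1"
    using character_separates[OF assms] by blast
  let ?T = "\<lambda>\<chi>. \<lambda>y\<in>carrier G. \<psi> y * \<chi> y"
  have inj: "inj_on ?T (characters G)"
  proof
    fix \<chi> \<chi>' assume c: "\<chi> \<in> characters G" "\<chi>' \<in> characters G" "?T \<chi> = ?T \<chi>'"
    have "\<chi> y = \<chi>' y" if "y \<in> carrier G" for y
      using fun_cong[OF c(3), of y] that character_on_norm[OF charactersD[OF psi(1)] that] by auto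
    then show "\<chi> = \<chi>'" using c by (auto simp: characters_def intro: extensionalityI)
  qed
  have sub: "?T ` characters G \<subseteq> characters G"
    using psi(1) by (auto simp: characters_def character_on_def norm_mult)
  have im: "?T ` characters G = characters G"
    using endo_inj_surj[OF finite_characters[OF fin] sub inj] .
  have "(\<Sum>\<chi>\<in>characters G. \<chi> x) = (\<Sum>\<chi>\<in>?T ` characters G. \<chi> x)" by (simp only: im)
  also have "\<dots> = (\<Sum>\<chi>\<in>characters G. \<psi> x * \<chi> x)"
    by (subst sum.reindex[OF inj]) (simp add: x)
  also have "\<dots> = \<psi> x * (\<Sum>\<chi>\<in>characters G. \<chi> x)" by (simp add: sum_distrib_left)
  finally show ?thesis using psi(2) by simp
qed

text \<open>The dual argument: translation by \<open>a\<close> permutes the group and multiplies the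
  sum by \<open>\<chi> a\<close>.\<close>

lemma sum_character_nontrivial:
  assumes fin: "finite (carrier G)" and chi: "\<chi> \<in> characters G"
    and nt: "a \<in> carrier G" "\<chi> a \<noteq> 1"
  shows "(\<Sum>x\<in>carrier G. \<chi> x) = 0"
proof -
  have "(\<Sum>x\<in>carrier G. \<chi> x) = (\<Sum>x\<in>carrier G. \<chi> (a \<otimes> x))"
    by (rule sum.reindex_bij_betw[symmetric, of "\<lambda>x. a \<otimes> x"])
      (use nt in \<open>auto simp: bij_betw_def inj_on_cmult surj_const_mult\<close>)
  also have "\<dots> = \<chi> a * (\<Sum>x\<in>carrier G. \<chi> x)"
    using nt by (simp add: sum_distrib_left character_on_mult[OF charactersD[OF chi]])
  finally show ?thesis using nt(2) by simp
qed

text \<open>Double counting of all values \<open>\<chi> x\<close>. Summed over characters first,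
  only the unit contributes; summed over the group first, only the trivial character does.\<close>

lemma card_characters:
  assumes fin: "finite (carrier G)"
  shows "card (characters G) = order G"
proof -
  define \<epsilon> :: "'a \<Rightarrow> complex" where "\<epsilon> = (\<lambda>x\<in>carrier G. 1)"
  have e: "\<epsilon> \<in> characters G" by (auto simp: \<epsilon>_def characters_def character_on_def)
  have "of_nat (card (characters G)) = (\<Sum>\<chi>\<in>characters G. \<chi> \<one>)"
    by (simp add: character_on_one[OF subgroup_self charactersD])
  also have "\<dots> = (\<Sum>x\<in>carrier G. \<Sum>\<chi>\<in>characters G. \<chi> x)"
    using fin by (subst sum.remove[of _ \<one>]) (auto simp: sum_characters_nonunit)
  also have "\<dots> = (\<Sum>\<chi>\<in>characters G. \<Sum>x\<in>carrier G. \<chi> x)" by (rule sum.swap)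
  also have "\<dots> = (\<Sum>x\<in>carrier G. \<epsilon> x)"
  proof -
    have "(\<Sum>x\<in>carrier G. \<chi> x) = 0" if "\<chi> \<in> characters G - {\<epsilon>}" for \<chi>
    proof -
      have "\<exists>a\<in>carrier G. \<chi> a \<noteq> 1"
      proof (rule ccontr)
        assume "\<not> ?thesis"
        then have "\<chi> = \<epsilon>" using that
          by (intro extensionalityI[of _ "carrier G"]) (auto simp: characters_def \<epsilon>_def)
        with that show False by simp
      qed
      then show ?thesis using sum_character_nontrivial[OF fin] that by blast
    qed
    then show ?thesis
      using e by (subst sum.remove[OF finite_characters[OF fin] e]) simp
  qed
  also have "\<dots> = of_nat (order G)" by (simp add: \<epsilon>_def order_def)
  finally show ?thesis by (simp only: of_nat_eq_iff)
qed

lemma sum_characters: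
  assumes fin: "finite (carrier G)" and x: "x \<in> carrier G"
  shows "(\<Sum>\<chi>\<in>characters G. \<chi> x) = (if x = \<one> then of_nat (order G) else 0)"
  using sum_characters_nonunit[OF fin x] card_characters[OF fin]
  by (auto simp: character_on_one[OF subgroup_self charactersD])

end

section \<open>Fourier analysis of the convolution\<close>

text \<open>Normalised by the order of the group like \<open>convolution\<close>, so that the
  coefficients of the convolution are plain squares and inversion is an unweighted sum over the
  characters.\<close>

definition fourier_coeff ::
  "('a, 'b) monoid_scheme \<Rightarrow> 'a set \<Rightarrow> ('a \<Rightarrow> complex) \<Rightarrow> complex" where
  "fourier_coeff G A \<chi> = (\<Sum>a\<in>A. cnj (\<chi> a)) / of_nat (order G)"

lemma sum_indicator_subset:
  assumes "finite C" "B \<subseteq> C"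
  shows "(\<Sum>x\<in>C. indicator B x) = real (card B)"
proof -
  have "(\<Sum>x\<in>C. indicator B x) = (\<Sum>x\<in>B. 1 :: real)"
    using assms by (intro sum.mono_neutral_cong_right) auto
  then show ?thesis by simp
qed

context comm_group
begin

text \<open>The symmetric sum over pairs is the form in which sums can be exchanged and
  orthogonality applied.\<close>

lemma convolution_indicator:
  assumes fin: "finite (carrier G)" and A: "A \<subseteq> carrier G" and x: "x \<in> carrier G"
  shows "convolution G (indicator A) (indicator A) x =
    (\<Sum>a\<in>A. \<Sum>b\<in>A. if a \<otimes> b = x then 1 else 0) / real (order G)"
proof -
  have finA: "finite A" using A fin by (rule finite_subset)
  have "(\<Sum>y\<in>carrier G. indicator A y * indicator A (x \<otimes> inv y) :: real)
      = (\<Sum>y\<in>A. indicator A (x \<otimes> inv y))"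
    using fin A by (intro sum.mono_neutral_cong_right) auto
  also have "\<dots> = (\<Sum>a\<in>A. \<Sum>b\<in>A. if a \<otimes> b = x then 1 else 0)"
  proof (rule sum.cong)
    fix a assume a: "a \<in> A"
    have "(a \<otimes> b = x) = (b = x \<otimes> inv a)" if "b \<in> A" for b
      using that a A x by (metis inv_solve_right m_comm subsetD)
    then have "(\<Sum>b\<in>A. if a \<otimes> b = x then 1 else 0) = (\<Sum>b\<in>A. if b = x \<otimes> inv a then 1 else 0 :: real)"
      by (intro sum.cong) auto
    also have "\<dots> = indicator A (x \<otimes> inv a)"
      using finA by (simp add: indicator_def)
    finally show "indicator A (x \<otimes> inv a) = (\<Sum>b\<in>A. if a \<otimes> b = x then 1 else 0 :: real)" ..
  qed auto
  finally show ?thesis by (simp add: convolution_def)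
qed

lemma convolution_eq_0:
  assumes "finite (carrier G)" "A \<subseteq> carrier G" "x \<in> carrier G" "x \<notin> A <#> A"
  shows "convolution G (indicator A) (indicator A) x = 0"
proof -
  have "a \<otimes> b \<noteq> x" if "a \<in> A" "b \<in> A" for a b
    using assms(4) that by (auto simp: set_mult_def)
  then show ?thesis by (simp add: convolution_indicator[OF assms(1-3)])
qed

lemma convolution_le_density:
  assumes "finite (carrier G)" "A \<subseteq> carrier G"
  shows "convolution G (indicator A) (indicator A) x \<le> real (card A) / real (order G)"
proof -
  have "(\<Sum>y\<in>carrier G. indicator A y * indicator A (x \<otimes> inv y) :: real)
      \<le> (\<Sum>y\<in>carrier G. indicator A y)"
    by (intro sum_mono) (auto simp: indicator_def)
  also have "\<dots> = real (card A)"
    using assms by (rule sum_indicator_subset)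
  finally show ?thesis by (simp add: convolution_def divide_right_mono)
qed

lemma sum_convolution:
  assumes fin: "finite (carrier G)" and A: "A \<subseteq> carrier G"
  shows "(\<Sum>x\<in>carrier G. convolution G (indicator A) (indicator A) x)
    = (real (card A))\<^sup>2 / real (order G)"
proof -
  have "(\<Sum>x\<in>carrier G. convolution G (indicator A) (indicator A) x)
      = (\<Sum>x\<in>carrier G. \<Sum>a\<in>A. \<Sum>b\<in>A. if a \<otimes> b = x then 1 else 0) / real (order G)"
    by (simp add: convolution_indicator[OF assms] sum_divide_distrib)
  also have "(\<Sum>x\<in>carrier G. \<Sum>a\<in>A. \<Sum>b\<in>A. if a \<otimes> b = x then 1 else 0 :: real)
      = (\<Sum>a\<in>A. \<Sum>b\<in>A. \<Sum>x\<in>carrier G. if a \<otimes> b = x then 1 else 0)"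
    by (subst sum.swap, rule sum.cong, rule refl, rule sum.swap)
  also have "\<dots> = (\<Sum>a\<in>A. \<Sum>b\<in>A. 1)"
    using fin A by (intro sum.cong) (auto simp: subset_iff)
  finally show ?thesis by (simp add: power2_eq_square)
qed

text \<open>The square is expanded over pairs \<open>a\<close>, \<open>b\<close> and conjugates
  become inverses; orthogonality then keeps exactly the pairs with
  \<open>a \<otimes> b = x\<close>.\<close>

lemma fourier_inversion_convolution:
  assumes fin: "finite (carrier G)" and A: "A \<subseteq> carrier G" and x: "x \<in> carrier G"
  shows "(\<Sum>\<chi>\<in>characters G. (fourier_coeff G A \<chi>)\<^sup>2 * \<chi> x)
    = of_real (convolution G (indicator A) (indicator A) x)"
proof -
  let ?n = "of_nat (order G) :: complex"
  have n: "?n \<noteq> 0" using fin by (simp add: order_gt_0_iff_finite)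
  have expand: "(fourier_coeff G A \<chi>)\<^sup>2 * \<chi> x = (\<Sum>a\<in>A. \<Sum>b\<in>A. \<chi> (inv (a \<otimes> b) \<otimes> x)) / ?n\<^sup>2"
    if chi: "\<chi> \<in> characters G" for \<chi>
  proof -
    note c = charactersD[OF chi]
    have "(\<Sum>a\<in>A. cnj (\<chi> a))\<^sup>2 * \<chi> x = (\<Sum>a\<in>A. \<Sum>b\<in>A. cnj (\<chi> a) * cnj (\<chi> b) * \<chi> x)"
      unfolding power2_eq_square sum_product by (simp only: sum_distrib_right)
    also have "\<dots> = (\<Sum>a\<in>A. \<Sum>b\<in>A. \<chi> (inv (a \<otimes> b) \<otimes> x))"
      using A x
      by (intro sum.cong) (auto simp: subset_iff character_on_mult[OF c] character_on_inv[OF subgroup_self c])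
    finally show ?thesis by (simp add: fourier_coeff_def power_divide)
  qed
  have "(\<Sum>\<chi>\<in>characters G. (fourier_coeff G A \<chi>)\<^sup>2 * \<chi> x)
      = (\<Sum>\<chi>\<in>characters G. \<Sum>a\<in>A. \<Sum>b\<in>A. \<chi> (inv (a \<otimes> b) \<otimes> x)) / ?n\<^sup>2"
    by (simp add: expand sum_divide_distrib)
  also have "(\<Sum>\<chi>\<in>characters G. \<Sum>a\<in>A. \<Sum>b\<in>A. \<chi> (inv (a \<otimes> b) \<otimes> x))
      = (\<Sum>a\<in>A. \<Sum>b\<in>A. \<Sum>\<chi>\<in>characters G. \<chi> (inv (a \<otimes> b) \<otimes> x))"
    by (subst sum.swap, rule sum.cong, rule refl, rule sum.swap)
  also have "\<dots> = (\<Sum>a\<in>A. \<Sum>b\<in>A. ?n * of_real (if a \<otimes> b = x then 1 else 0))"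
  proof (intro sum.cong refl)
    fix a b assume "a \<in> A" "b \<in> A"
    then have ab: "a \<otimes> b \<in> carrier G" using A by auto
    have "(inv (a \<otimes> b) \<otimes> x = \<one>) = (a \<otimes> b = x)"
      using ab x by (metis inv_closed inv_inv inv_equality l_inv)
    then show "(\<Sum>\<chi>\<in>characters G. \<chi> (inv (a \<otimes> b) \<otimes> x)) = ?n * of_real (if a \<otimes> b = x then 1 else 0)"
      using ab x by (simp add: sum_characters[OF fin])
  qed
  also have "\<dots> = ?n * of_real (\<Sum>a\<in>A. \<Sum>b\<in>A. if a \<otimes> b = x then 1 else 0)"
    by (simp only: sum_distrib_left of_real_sum)
  also have "\<dots> / ?n\<^sup>2 = of_real (convolution G (indicator A) (indicator A) x)"
    using n by (simp add: convolution_indicator[OF assms] power2_eq_square)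
  finally show ?thesis .
qed

text \<open>The same expansion with \<open>inv a \<otimes> b\<close>, where orthogonality keeps the
  diagonal.\<close>

lemma fourier_parseval:
  assumes fin: "finite (carrier G)" and A: "A \<subseteq> carrier G"
  shows "(\<Sum>\<chi>\<in>characters G. (norm (fourier_coeff G A \<chi>))\<^sup>2) = real (card A) / real (order G)"
proof -
  let ?n = "of_nat (order G) :: complex"
  have n: "?n \<noteq> 0" using fin by (simp add: order_gt_0_iff_finite)
  have finA: "finite A" using A fin by (rule finite_subset)
  have expand: "of_real ((norm (fourier_coeff G A \<chi>))\<^sup>2) = (\<Sum>a\<in>A. \<Sum>b\<in>A. \<chi> (inv a \<otimes> b)) / ?n\<^sup>2"
    if chi: "\<chi> \<in> characters G" for \<chi>
  proof -
    note c = charactersD[OF chi]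
    have "(\<Sum>a\<in>A. cnj (\<chi> a)) * (\<Sum>b\<in>A. \<chi> b) = (\<Sum>a\<in>A. \<Sum>b\<in>A. \<chi> (inv a \<otimes> b))"
      unfolding sum_product using A
      by (intro sum.cong) (auto simp: subset_iff character_on_mult[OF c] character_on_inv[OF subgroup_self c])
    then show ?thesis
      unfolding complex_norm_square
      by (simp add: fourier_coeff_def power2_eq_square)
  qed
  have "of_real (\<Sum>\<chi>\<in>characters G. (norm (fourier_coeff G A \<chi>))\<^sup>2)
      = (\<Sum>\<chi>\<in>characters G. \<Sum>a\<in>A. \<Sum>b\<in>A. \<chi> (inv a \<otimes> b)) / ?n\<^sup>2"
    unfolding of_real_sum by (simp only: expand sum_divide_distrib cong: sum.cong)
  also have "(\<Sum>\<chi>\<in>characters G. \<Sum>a\<in>A. \<Sum>b\<in>A. \<chi> (inv a \<otimes> b))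
      = (\<Sum>a\<in>A. \<Sum>b\<in>A. \<Sum>\<chi>\<in>characters G. \<chi> (inv a \<otimes> b))"
    by (subst sum.swap, rule sum.cong, rule refl, rule sum.swap)
  also have "\<dots> = (\<Sum>a\<in>A. \<Sum>b\<in>A. if a = b then ?n else 0)"
  proof (intro sum.cong refl)
    fix a b assume ab: "a \<in> A" "b \<in> A"
    then have ab: "a \<in> carrier G" "b \<in> carrier G" using A by auto
    then have "(inv a \<otimes> b = \<one>) = (a = b)"
      by (metis inv_closed inv_inv inv_equality l_inv)
    then show "(\<Sum>\<chi>\<in>characters G. \<chi> (inv a \<otimes> b)) = (if a = b then ?n else 0)"
      using ab by (simp add: sum_characters[OF fin])
  qed
  also have "\<dots> = of_nat (card A) * ?n"
    using finA by simp
  also have "\<dots> / ?n\<^sup>2 = of_real (real (card A) / real (order G))"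
    using n by (simp add: power2_eq_square)
  finally show ?thesis by (simp only: of_real_eq_iff)
qed

end

text \<open>
  The functions \<open>Re (\<i>\<^sup>k \<chi>)\<close> for \<open>k < 4\<close> and the weights with which they average to
  \<open>A * A / (2 \<alpha>)\<close>. Four fixed phases suffice, so the phases of the Fourier coefficients of \<open>A\<close>
  enter only through the weights and the functions do not depend on \<open>A\<close>.
\<close>

definition char_functions :: "('a, 'b) monoid_scheme \<Rightarrow> (('a \<Rightarrow> complex) \<times> nat) set" where
  "char_functions G = characters G \<times> {..<4}"

definition char_fun :: "('a \<Rightarrow> complex) \<times> nat \<Rightarrow> 'a \<Rightarrow> real" where
  "char_fun i x = Re (\<i> ^ snd i * fst i x)"

text \<open>The squared modulus dominates the real part of every rotation of the squared
  coefficient, so adding it makes the weight nonnegative.\<close>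

definition char_weight ::
  "('a, 'b) monoid_scheme \<Rightarrow> real \<Rightarrow> 'a set \<Rightarrow> ('a \<Rightarrow> complex) \<times> nat \<Rightarrow> real" where
  "char_weight G \<alpha> A i = ((norm (fourier_coeff G A (fst i)))\<^sup>2
     + Re ((- \<i>) ^ snd i * (fourier_coeff G A (fst i))\<^sup>2)) / (4 * \<alpha>)"

lemma sum_lessThan_4: "sum f {..<4::nat} = f 0 + f 1 + f 2 + (f 3 :: 'b :: comm_monoid_add)"
  by (simp add: numeral_eq_Suc add.assoc)

lemma char_weight_nonneg:
  assumes "0 < \<alpha>"
  shows "0 \<le> char_weight G \<alpha> A i"
proof -
  let ?h = "fourier_coeff G A (fst i)"
  have "\<bar>Re ((- \<i>) ^ snd i * ?h\<^sup>2)\<bar> \<le> norm ((- \<i>) ^ snd i * ?h\<^sup>2)" by (rule abs_Re_le_cmod)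
  also have "\<dots> = (norm ?h)\<^sup>2" by (simp add: norm_mult norm_power)
  finally show ?thesis using assms by (simp add: char_weight_def)
qed

lemma abs_char_fun_le:
  assumes "i \<in> char_functions G" "x \<in> carrier G"
  shows "\<bar>char_fun i x\<bar> \<le> 1"
proof -
  have "fst i \<in> characters G" using assms by (auto simp: char_functions_def)
  then have "norm (\<i> ^ snd i * fst i x) = 1"
    using character_on_norm[OF charactersD assms(2)] by (simp add: norm_mult norm_power)
  then show ?thesis
    unfolding char_fun_def using abs_Re_le_cmod[of "\<i> ^ snd i * fst i x"] by simp
qed

context comm_group
begin

text \<open>The four rotations of the squared coefficient cancel, which leaves the squared moduli
  divided by \<open>\<alpha>\<close>, and Parseval applies.\<close>

lemma sum_char_weight:
  assumes fin: "finite (carrier G)" and A: "A \<subseteq> carrier G"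
    and card: "real (card A) = \<alpha> * real (order G)" and "0 < \<alpha>"
  shows "sum (char_weight G \<alpha> A) (char_functions G) = 1"
proof -
  have n: "real (order G) > 0" using fin by (simp add: order_gt_0_iff_finite)
  have "sum (char_weight G \<alpha> A) (char_functions G)
      = (\<Sum>\<chi>\<in>characters G. \<Sum>k<4. char_weight G \<alpha> A (\<chi>, k))"
    by (simp add: char_functions_def sum.cartesian_product)
  also have "\<dots> = (\<Sum>\<chi>\<in>characters G. (norm (fourier_coeff G A \<chi>))\<^sup>2 / \<alpha>)"
    using \<open>0 < \<alpha>\<close> by (intro sum.cong) (simp_all add: sum_lessThan_4 char_weight_def power3_eq_cube field_simps)
  also have "\<dots> = real (card A) / real (order G) / \<alpha>"
    by (simp add: fourier_parseval[OF fin A] flip: sum_divide_distrib)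
  finally show ?thesis using card n \<open>0 < \<alpha>\<close> by simp
qed

text \<open>Here the squared moduli drop out because the four rotations of \<open>\<chi> x\<close>
  sum to zero. For complex \<open>z\<close> and \<open>c\<close>, the products
  \<open>Re ((- \<i>) ^ k * z) * Re (\<i> ^ k * c)\<close> sum over \<open>k < 4\<close> to
  \<open>2 * Re (z * c)\<close>, whence the factor 2 beside \<open>\<alpha>\<close>.\<close>

lemma sum_char_weight_char_fun:
  assumes fin: "finite (carrier G)" and A: "A \<subseteq> carrier G" and x: "x \<in> carrier G" and "0 < \<alpha>"
  shows "(\<Sum>i\<in>char_functions G. char_weight G \<alpha> A i * char_fun i x)
    = convolution G (indicator A) (indicator A) x / (2 * \<alpha>)"
proof -
  have "(\<Sum>i\<in>char_functions G. char_weight G \<alpha> A i * char_fun i x)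
      = (\<Sum>\<chi>\<in>characters G. \<Sum>k<4. char_weight G \<alpha> A (\<chi>, k) * char_fun (\<chi>, k) x)"
    by (simp add: char_functions_def sum.cartesian_product case_prod_unfold)
  also have "\<dots> = (\<Sum>\<chi>\<in>characters G. Re ((fourier_coeff G A \<chi>)\<^sup>2 * \<chi> x) / (2 * \<alpha>))"
    using \<open>0 < \<alpha>\<close>
    by (intro sum.cong)
      (simp_all add: sum_lessThan_4 char_weight_def char_fun_def power3_eq_cube field_simps)
  also have "\<dots> = Re (\<Sum>\<chi>\<in>characters G. (fourier_coeff G A \<chi>)\<^sup>2 * \<chi> x) / (2 * \<alpha>)"
    by (simp only: Re_sum sum_divide_distrib)
  finally show ?thesis by (simp add: fourier_inversion_convolution[OF fin A x])
qed

text \<open>With error \<open>e * m\<close> for the sample sum, the cut is placed at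
  \<open>e * m\<close>: off the sumset the expected sum is 0 and cannot exceed the cut, while on the
  level set it is more than \<open>2 * e * m\<close> and must.\<close>

lemma exists_sampled_superlevel_set:
  assumes fin: "finite (carrier G)" and A: "A \<subseteq> carrier G"
    and card: "real (card A) = \<alpha> * real (order G)" and \<alpha>: "0 < \<alpha>"
    and m: "1024 * 4 ^ l * ln (2 * real (order G)) \<le> real m"
  shows "\<exists>s. set s \<subseteq> char_functions G \<and> length s = m \<and>
    level_set G \<alpha> A l \<subseteq> {x \<in> carrier G. real m / 2 ^ (l + 3) < (\<Sum>i\<leftarrow>s. char_fun i x)} \<and>
    {x \<in> carrier G. real m / 2 ^ (l + 3) < (\<Sum>i\<leftarrow>s. char_fun i x)} \<subseteq> A <#> A"
proof -
  define e :: real where "e = 1 / 2 ^ (l + 3)"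
  have e: "0 < e" "e \<le> 4"
  proof -
    have "(1::real) \<le> 2 ^ (l + 3)" by (rule one_le_power) simp
    then have "e \<le> 1" by (simp add: e_def)
    then show "e \<le> 4" by simp
    show "0 < e" by (simp add: e_def)
  qed
  \<comment> \<open>The constant 1024 in the hypothesis on \<open>m\<close> is 16 times this
    64.\<close>
  have "e\<^sup>2 = 1 / (64 * 4 ^ l)"
    by (simp add: e_def power2_eq_square power_add power_mult_distrib[symmetric])
  then have m': "16 * ln (2 * real (card (carrier G))) / e\<^sup>2 \<le> real m"
    using m by (simp add: order_def mult_ac)
  have I: "finite (char_functions G)"
    by (simp add: char_functions_def finite_characters[OF fin])
  obtain s where s: "set s \<subseteq> char_functions G" "length s = m" and
    close: "\<And>x. x \<in> carrier G \<Longrightarrow> \<bar>(\<Sum>i\<leftarrow>s. char_fun i x)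
      - real m * (convolution G (indicator A) (indicator A) x / (2 * \<alpha>))\<bar> \<le> e * real m"
    using exists_sample_uniform[OF I, of "char_weight G \<alpha> A" "carrier G" char_fun e m]
      char_weight_nonneg[OF \<alpha>] sum_char_weight[OF fin A card \<alpha>] abs_char_fun_le fin e m'
    by (force simp: sum_char_weight_char_fun[OF fin A _ \<alpha>])
  have npos: "0 < order G" using fin by (simp add: order_gt_0_iff_finite)
  \<comment> \<open>The factor 2 keeps the logarithm positive even for the trivial group. The strict
    inequality on the level set relies on \<open>m > 0\<close>.\<close>
  have "0 < ln (2 * real (order G))" using npos by (intro ln_gt_zero) linarith
  then have "0 < 1024 * 4 ^ l * ln (2 * real (order G))" by simp
  with m have mpos: "0 < real m" by linarith
  let ?F = "{x \<in> carrier G. real m / 2 ^ (l + 3) < (\<Sum>i\<leftarrow>s. char_fun i x)}"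
  have "level_set G \<alpha> A l \<subseteq> ?F"
  proof
    fix x assume "x \<in> level_set G \<alpha> A l"
    then have x: "x \<in> carrier G"
      and gt: "\<alpha> / 2 ^ (l + 1) < convolution G (indicator A) (indicator A) x"
      by (auto simp: level_set_def)
    have "2 * e < convolution G (indicator A) (indicator A) x / (2 * \<alpha>)"
      using gt \<alpha> by (simp add: e_def power_add field_simps)
    then have "real m * (2 * e) < real m * (convolution G (indicator A) (indicator A) x / (2 * \<alpha>))"
      using mpos by (rule mult_strict_left_mono)
    moreover have "real m * (2 * e) = 2 * (e * real m)" by simp
    ultimately have "e * real m < (\<Sum>i\<leftarrow>s. char_fun i x)"
      using close[OF x] unfolding abs_le_iff by linarith
    then show "x \<in> ?F" using x by (simp add: e_def)
  qed
  moreover have "?F \<subseteq> A <#> A"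
  proof
    fix x assume x: "x \<in> ?F"
    show "x \<in> A <#> A"
    proof (rule ccontr)
      assume "x \<notin> A <#> A"
      then have "convolution G (indicator A) (indicator A) x = 0"
        using x by (intro convolution_eq_0[OF fin A]) auto
      with close[of x] x show False by (simp add: e_def abs_le_iff)
    qed
  qed
  ultimately show ?thesis using s by blast
qed

end

section \<open>Existence of a popular level\<close>

lemma dyadic_level_exists:
  fixes y \<alpha> :: real
  assumes "y \<le> \<alpha>" "\<alpha> / 2 ^ (N + 1) < y"
  shows "\<exists>l\<le>N. y \<in> {\<alpha> / 2 ^ (l + 1) <.. \<alpha> / 2 ^ l}"
  using assms
proof (induction N)
  case (Suc N)
  show ?case
  proof (cases "\<alpha> / 2 ^ (N + 1) < y")
    case True
    with Suc show ?thesis by (meson le_SucI)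
  next
    case False
    with Suc.prems show ?thesis by (intro exI[of _ "Suc N"]) auto
  qed
qed auto

text \<open>The terms at 0 and 1 both equal 1, and the later ones telescope. The induction carries
  the stronger bound with \<open>1 / real (Suc M)\<close> subtracted.\<close>

lemma sum_inverse_squares_lt_3: "(\<Sum>l\<le>N. 1 / (max 1 (real l))\<^sup>2) < 3"
proof -
  have "(\<Sum>l\<le>Suc M. 1 / (max 1 (real l))\<^sup>2) \<le> 3 - 1 / real (Suc M)" for M
  proof (induction M)
    case (Suc M)
    define r where "r = real M"
    have r: "r \<ge> 0" by (simp add: r_def)
    have "1 / (r + 2)\<^sup>2 \<le> 1 / ((r + 1) * (r + 2))"
      using r by (intro divide_left_mono) (auto simp: power2_eq_square)
    also have "\<dots> = 1 / (r + 1) - 1 / (r + 2)" using r by (simp add: field_simps)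
    finally have "1 / (max 1 (real (Suc (Suc M))))\<^sup>2 \<le> 1 / real (Suc M) - 1 / real (Suc (Suc M))"
      by (simp add: r_def max_def add_ac)
    then show ?case using Suc by (simp del: of_nat_Suc)
  qed simp
  moreover have "1 / real (Suc N) > 0" by simp
  moreover have "(\<Sum>l\<le>N. 1 / (max 1 (real l))\<^sup>2) \<le> (\<Sum>l\<le>Suc N. 1 / (max 1 (real l))\<^sup>2)" by simp
  ultimately show ?thesis by (smt (verit))
qed

text \<open>The constant 1/6 balances the mass. Rounding up gives \<open>K \<le> 2 ^ N\<close>, so
  the part of the sumset below the last level carries at most half of
  \<open>\<alpha>\<^sup>2 * n\<close>. Levels that all miss the threshold carry at most
  \<open>\<alpha>\<^sup>2 * n / 6\<close> times a series below 3, hence less than the other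
  half.\<close>

lemma (in comm_group) popular_level_exists:
  assumes fin: "finite (carrier G)" and \<alpha>: "0 < \<alpha>" and K: "K \<ge> 1" and A: "A \<subseteq> carrier G"
    and doubling: "real (card (A <#> A)) \<le> K * real (card A)"
    and card: "real (card A) = \<alpha> * real (order G)"
  shows "\<exists>l. popular_level G (1/6) \<alpha> A (of_int \<lceil>log 2 K\<rceil>) l"
proof (rule ccontr)
  assume none: "\<not> ?thesis"
  define N where "N = nat \<lceil>log 2 K\<rceil>"
  define n where "n = real (order G)"
  define r where "r = convolution G (indicator A) (indicator A)"
  have logK: "0 \<le> log 2 K" using K by simp
  have N: "real N = of_int \<lceil>log 2 K\<rceil>" using logK by (simp add: N_def)
  have n: "n > 0" unfolding n_def using fin by (simp add: order_gt_0_iff_finite)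
  have "log 2 K \<le> real N" using N by linarith
  then have KN: "K \<le> 2 ^ N" using K by (simp add: log_le_iff powr_realpow)
  have small: "real (card (level_set G \<alpha> A l)) \<le> 1/6 * 2 ^ l * \<alpha> * n / (max 1 (real l))\<^sup>2"
    if "l \<le> N" for l
  proof -
    have "real l \<le> of_int \<lceil>log 2 K\<rceil>" unfolding N[symmetric] using that by simp
    with none have "real (card (level_set G \<alpha> A l)) < level_threshold (1/6) \<alpha> (order G) l"
      unfolding popular_level_def by (meson not_le)
    then show ?thesis unfolding level_threshold_def n_def by (rule less_imp_le)
  qed
  have sumset: "A <#> A \<subseteq> carrier G" using A by (simp add: setmult_subset_G)
  have lev: "level_set G \<alpha> A l \<subseteq> carrier G" for l by (auto simp: level_set_def)
  \<comment> \<open>A point above the lowest cut lies in some level up to \<open>N\<close>; any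
    other is bounded by that cut, and by 0 outside the sumset.\<close>
  have r_le: "r x \<le> \<alpha> / 2 ^ (N + 1) * indicator (A <#> A) x
      + (\<Sum>l\<le>N. \<alpha> / 2 ^ l * indicator (level_set G \<alpha> A l) x)" if x: "x \<in> carrier G" for x
  proof (cases "\<alpha> / 2 ^ (N + 1) < r x")
    case True
    have "r x \<le> \<alpha>"
      using convolution_le_density[OF fin A, of x] card n by (simp add: r_def n_def)
    with True obtain l where l: "l \<le> N" "r x \<in> {\<alpha> / 2 ^ (l + 1) <.. \<alpha> / 2 ^ l}"
      using dyadic_level_exists by blast
    then have xl: "x \<in> level_set G \<alpha> A l" using x by (simp add: level_set_def r_def)
    have "r x \<le> \<alpha> / 2 ^ l * indicator (level_set G \<alpha> A l) x" using l xl by simp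
    also have "\<dots> \<le> (\<Sum>l\<le>N. \<alpha> / 2 ^ l * indicator (level_set G \<alpha> A l) x)"
      using l \<alpha> by (intro member_le_sum) auto
    moreover have "0 \<le> \<alpha> / 2 ^ (N + 1) * indicator (A <#> A) x" using \<alpha> by simp
    ultimately show ?thesis by linarith
  next
    case False
    have "0 \<le> (\<Sum>l\<le>N. \<alpha> / 2 ^ l * indicator (level_set G \<alpha> A l) x)"
      using \<alpha> by (intro sum_nonneg) simp
    moreover have "r x \<le> \<alpha> / 2 ^ (N + 1) * indicator (A <#> A) x"
      using False convolution_eq_0[OF fin A x] by (cases "x \<in> A <#> A") (auto simp: r_def)
    ultimately show ?thesis by linarith
  qed
  have "\<alpha>\<^sup>2 * n = (\<Sum>x\<in>carrier G. r x)"
    unfolding r_def sum_convolution[OF fin A] card using n by (simp add: n_def power2_eq_square)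
  also have "\<dots> \<le> (\<Sum>x\<in>carrier G. \<alpha> / 2 ^ (N + 1) * indicator (A <#> A) x
      + (\<Sum>l\<le>N. \<alpha> / 2 ^ l * indicator (level_set G \<alpha> A l) x))"
    by (intro sum_mono r_le)
  also have "\<dots> = \<alpha> / 2 ^ (N + 1) * (\<Sum>x\<in>carrier G. indicator (A <#> A) x)
      + (\<Sum>l\<le>N. \<alpha> / 2 ^ l * (\<Sum>x\<in>carrier G. indicator (level_set G \<alpha> A l) x))"
    unfolding sum.distrib sum_distrib_left by (subst (2) sum.swap) (rule refl)
  also have "\<dots> = \<alpha> / 2 ^ (N + 1) * real (card (A <#> A))
      + (\<Sum>l\<le>N. \<alpha> / 2 ^ l * real (card (level_set G \<alpha> A l)))"
    by (simp only: sum_indicator_subset[OF fin sumset] sum_indicator_subset[OF fin lev])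
  also have "\<dots> \<le> \<alpha> / 2 ^ (N + 1) * (2 ^ N * (\<alpha> * n))
      + (\<Sum>l\<le>N. \<alpha> / 2 ^ l * (1/6 * 2 ^ l * \<alpha> * n / (max 1 (real l))\<^sup>2))"
  proof (intro add_mono mult_left_mono sum_mono small)
    have "K * real (card A) \<le> 2 ^ N * (\<alpha> * n)"
      unfolding card n_def[symmetric] using KN \<alpha> n by (intro mult_right_mono) auto
    with doubling show "real (card (A <#> A)) \<le> 2 ^ N * (\<alpha> * n)" by linarith
  qed (use \<alpha> in auto)
  also have "\<dots> = \<alpha>\<^sup>2 * n / 2 + \<alpha>\<^sup>2 * n / 6 * (\<Sum>l\<le>N. 1 / (max 1 (real l))\<^sup>2)"
    unfolding sum_distrib_left by (simp add: power2_eq_square mult.assoc)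
  also have "\<dots> < \<alpha>\<^sup>2 * n / 2 + \<alpha>\<^sup>2 * n / 6 * 3"
    using \<alpha> n by (intro add_strict_left_mono mult_strict_left_mono sum_inverse_squares_lt_3) auto
  also have "\<dots> = \<alpha>\<^sup>2 * n" by simp
  finally show False by simp
qed

section \<open>The covering family\<close>

definition sample_size :: "nat \<Rightarrow> nat \<Rightarrow> nat" where
  "sample_size n l = nat \<lceil>1024 * 4 ^ l * ln (2 * real n)\<rceil>"

text \<open>The sets depend on \<open>G\<close> and \<open>l\<close> alone; a set \<open>A\<close>
  only determines which list \<open>s\<close> is selected.\<close>

definition sampled_sets :: "('a, 'b) monoid_scheme \<Rightarrow> nat \<Rightarrow> 'a set set" where
  "sampled_sets G l =
     (\<lambda>s. {x \<in> carrier G. real (sample_size (order G) l) / 2 ^ (l + 3) < (\<Sum>i\<leftarrow>s. char_fun i x)})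
       ` {s. set s \<subseteq> char_functions G \<and> length s = sample_size (order G) l}"

text \<open>The lists are counted: there are \<open>4 * order G\<close> functions and
  \<open>sample_size\<close> places. From order 2 on, the logarithm of the order is at least 1/2 and
  absorbs the additive constants.\<close>

lemma (in comm_group) card_sampled_sets:
  assumes fin: "finite (carrier G)" and n: "order G \<ge> 2"
  shows "finite (sampled_sets G l)"
    and "real (card (sampled_sets G l)) \<le> exp (6150 * 2 ^ (2 * l) * (ln (real (order G)))\<^sup>2)"
proof -
  let ?m = "sample_size (order G) l" and ?L = "ln (real (order G))"
  have I: "finite (char_functions G)"
    by (simp add: char_functions_def finite_characters[OF fin])
  show "finite (sampled_sets G l)"
    unfolding sampled_sets_def using I by (intro finite_imageI finite_lists_length_eq)
  have cI: "card (char_functions G) = 4 * order G"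
    by (simp add: char_functions_def card_cartesian_product card_characters[OF fin])
  have "card (sampled_sets G l) \<le> card (char_functions G) ^ ?m"
    unfolding sampled_sets_def card_lists_length_eq[OF I, symmetric]
    using I by (intro card_image_le finite_lists_length_eq)
  then have "real (card (sampled_sets G l)) \<le> (4 * real (order G)) ^ ?m"
    unfolding cI by (metis of_nat_le_iff of_nat_mult of_nat_numeral of_nat_power)
  also have "\<dots> = exp (real ?m * ln (4 * real (order G)))"
    using n by (simp add: exp_of_nat_mult)
  \<comment> \<open>Of 2050, the part 2048 comes from \<open>ln (2 * n) \<le> 2 * ln n\<close> and
    the remaining 2 pays for rounding up. The factor 3 is
    \<open>ln 4 = 2 * ln 2 \<le> 2 * ln n\<close> plus \<open>ln n\<close>.\<close>
  also have "real ?m * ln (4 * real (order G)) \<le> (2050 * 4 ^ l * ?L) * (3 * ?L)"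
  proof (rule mult_mono)
    have ln2: "ln 2 \<le> ?L" using n by simp
    \<comment> \<open>The quadratic bound at 1/2 is 7/4.\<close>
    have "exp (1/2) \<le> (2::real)" using exp_le_quadratic[of "1/2"] by (simp add: power2_eq_square)
    then have "1/2 \<le> ln (2::real)" by (simp only: ln_ge_iff zero_less_numeral)
    with ln2 have half: "1/2 \<le> ?L" by linarith
    have ln4: "ln (4::real) = 2 * ln 2" using ln_realpow[of 2 2] by simp
    show "ln (4 * real (order G)) \<le> 3 * ?L"
      using n ln2 ln4 by (simp add: ln_mult)
    have l2: "ln (2 * real (order G)) \<le> 2 * ?L" "0 \<le> ln (2 * real (order G))"
      using n ln2 by (simp_all add: ln_mult)
    have "(1::real) \<le> 4 ^ l * (2 * ?L)"
      using half mult_mono[of 1 "4 ^ l" 1 "2 * ?L"] by simp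
    moreover have "real ?m \<le> 1024 * 4 ^ l * ln (2 * real (order G)) + 1"
    proof -
      have "0 \<le> 1024 * 4 ^ l * ln (2 * real (order G))" using l2 by simp
      then show ?thesis unfolding sample_size_def by linarith
    qed
    moreover have "4 ^ l * ln (2 * real (order G)) \<le> 4 ^ l * (2 * ?L)"
      using l2 by (intro mult_left_mono) auto
    ultimately show "real ?m \<le> 2050 * 4 ^ l * ?L" by linarith
  qed (use n in auto)
  also have "(2050 * 4 ^ l * ?L) * (3 * ?L) = 6150 * 2 ^ (2 * l) * ?L\<^sup>2"
    by (simp add: power_mult power2_eq_square)
  finally show "real (card (sampled_sets G l)) \<le> exp (6150 * 2 ^ (2 * l) * ?L\<^sup>2)" by simp
qed

lemma (in comm_group) sampled_sets_cover:
  assumes fin: "finite (carrier G)" and A: "A \<subseteq> carrier G"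
    and card: "real (card A) = \<alpha> * real (order G)" and \<alpha>: "0 < \<alpha>"
  shows "\<exists>F\<in>sampled_sets G l. F \<subseteq> A <#> A \<and> level_set G \<alpha> A l \<subseteq> F"
proof -
  have "1024 * 4 ^ l * ln (2 * real (order G)) \<le> real (sample_size (order G) l)"
    unfolding sample_size_def by linarith
  from exists_sampled_superlevel_set[OF assms this] show ?thesis
    unfolding sampled_sets_def by blast
qed

section \<open>Assembly of the covering theorem\<close>

theorem theorem2p4:
  "\<exists>C::real. \<exists>c::real. C > 0 \<and> c > 0 \<and>
    (\<forall>(G :: 'a monoid) (\<alpha>::real).
      comm_group G \<longrightarrow> finite (carrier G) \<longrightarrow> 0 < \<alpha> \<longrightarrow> \<alpha> < 1 \<longrightarrow>
      (\<exists>\<F> :: nat \<Rightarrow> 'a set set.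
        (\<forall>l. \<F> l \<subseteq> Pow (carrier G) \<and>
             real (card (\<F> l)) \<le> exp (C * 2 ^ (2 * l) * (ln (real (order G)))\<^sup>2) \<and>
             (\<forall>F\<in>\<F> l. real (card F) \<ge> level_threshold c \<alpha> (order G) l)) \<and>
        (\<forall>(K::real) A.
          K \<ge> 1 \<longrightarrow> A \<subseteq> carrier G \<longrightarrow>
          real (card (A <#>\<^bsub>G\<^esub> A)) \<le> K * real (card A) \<longrightarrow>
          real (card A) = \<alpha> * real (order G) \<longrightarrow>
          ((\<exists>l. popular_level G c \<alpha> A (log 2 K) l) \<longrightarrow>
            (let l = (LEAST l. popular_level G c \<alpha> A (log 2 K) l)
             in \<exists>F\<in>\<F> l. F \<subseteq> A <#>\<^bsub>G\<^esub> A \<and> level_set G \<alpha> A l \<subseteq> F)) \<and>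
          (\<exists>l. popular_level G c \<alpha> A (of_int \<lceil>log 2 K\<rceil>) l) \<and>
          (let l = (LEAST l. popular_level G c \<alpha> A (of_int \<lceil>log 2 K\<rceil>) l)
           in \<exists>F\<in>\<F> l. F \<subseteq> A <#>\<^bsub>G\<^esub> A \<and> level_set G \<alpha> A l \<subseteq> F))))"
\<comment> \<open>6150 is the constant of \<open>card_sampled_sets\<close>, and 1/6 that of
  \<open>popular_level_exists\<close>.\<close>
proof (rule exI[of _ 6150], rule exI[of _ "1/6"], intro conjI allI impI)
  fix G :: "'a monoid" and \<alpha> :: real
  assume G: "comm_group G" and fin: "finite (carrier G)" and \<alpha>: "0 < \<alpha>" "\<alpha> < 1"
  interpret comm_group G by (rule G)
  let ?c = "1/6 :: real"
  \<comment> \<open>The trivial group is excluded because there the bound on \<open>\<F> l\<close> is 1; no \<open>A\<close> has density \<open>\<alpha>\<close>.\<close>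
  define \<F> where "\<F> l = (if order G = 1 then {} else
    {F \<in> sampled_sets G l. real (card F) \<ge> level_threshold ?c \<alpha> (order G) l})" for l
  have npos: "0 < order G" using fin by (simp add: order_gt_0_iff_finite)
  have size: "real (card (\<F> l)) \<le> exp (6150 * 2 ^ (2 * l) * (ln (real (order G)))\<^sup>2)" for l
  proof (cases "order G = 1")
    case False
    with npos have n: "order G \<ge> 2" by simp
    have "card (\<F> l) \<le> card (sampled_sets G l)"
      using card_sampled_sets(1)[OF fin n] by (intro card_mono) (auto simp: \<F>_def)
    then show ?thesis using card_sampled_sets(2)[OF fin n, of l] by linarith
  qed (simp add: \<F>_def)
  have sub: "\<F> l \<subseteq> Pow (carrier G)" for l
    by (auto simp: \<F>_def sampled_sets_def split: if_splits)
  have large: "\<forall>F\<in>\<F> l. real (card F) \<ge> level_threshold ?c \<alpha> (order G) l" for l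
    by (auto simp: \<F>_def split: if_splits)
  \<comment> \<open>The bound \<open>b\<close> stays arbitrary so that one fact serves both the
    range up to \<open>log 2 K\<close> and the range up to its ceiling.\<close>
  have cover: "\<exists>F\<in>\<F> l. F \<subseteq> A <#>\<^bsub>G\<^esub> A \<and> level_set G \<alpha> A l \<subseteq> F"
    if A: "A \<subseteq> carrier G" and card: "real (card A) = \<alpha> * real (order G)"
      and pop: "popular_level G ?c \<alpha> A b l" for A b l
  proof -
    have "order G \<noteq> 1"
    proof
      assume "order G = 1"
      with card \<alpha> have "0 < real (card A)" "real (card A) < 1" by auto
      then show False by simp
    qed
    moreover obtain F where F: "F \<in> sampled_sets G l" "F \<subseteq> A <#>\<^bsub>G\<^esub> A" "level_set G \<alpha> A l \<subseteq> F"
      using sampled_sets_cover[OF fin A card \<alpha>(1)] by blast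
    \<comment> \<open>The covering set survives the restriction by size in \<open>\<F>\<close>
      because it contains a popular level set.\<close>
    moreover have "real (card F) \<ge> level_threshold ?c \<alpha> (order G) l"
    proof -
      have "finite F" using F(1) fin by (auto simp: sampled_sets_def)
      then have "card (level_set G \<alpha> A l) \<le> card F" using F(3) by (rule card_mono)
      then show ?thesis using pop unfolding popular_level_def by linarith
    qed
    ultimately show ?thesis by (auto simp: \<F>_def)
  qed
  show "\<exists>\<F> :: nat \<Rightarrow> 'a set set.
        (\<forall>l. \<F> l \<subseteq> Pow (carrier G) \<and>
             real (card (\<F> l)) \<le> exp (6150 * 2 ^ (2 * l) * (ln (real (order G)))\<^sup>2) \<and>
             (\<forall>F\<in>\<F> l. real (card F) \<ge> level_threshold ?c \<alpha> (order G) l)) \<and>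
        (\<forall>(K::real) A.
          K \<ge> 1 \<longrightarrow> A \<subseteq> carrier G \<longrightarrow>
          real (card (A <#>\<^bsub>G\<^esub> A)) \<le> K * real (card A) \<longrightarrow>
          real (card A) = \<alpha> * real (order G) \<longrightarrow>
          ((\<exists>l. popular_level G ?c \<alpha> A (log 2 K) l) \<longrightarrow>
            (let l = (LEAST l. popular_level G ?c \<alpha> A (log 2 K) l)
             in \<exists>F\<in>\<F> l. F \<subseteq> A <#>\<^bsub>G\<^esub> A \<and> level_set G \<alpha> A l \<subseteq> F)) \<and>
          (\<exists>l. popular_level G ?c \<alpha> A (of_int \<lceil>log 2 K\<rceil>) l) \<and>
          (let l = (LEAST l. popular_level G ?c \<alpha> A (of_int \<lceil>log 2 K\<rceil>) l)
           in \<exists>F\<in>\<F> l. F \<subseteq> A <#>\<^bsub>G\<^esub> A \<and> level_set G \<alpha> A l \<subseteq> F))"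
    unfolding Let_def
  proof (intro exI[of _ \<F>] conjI allI impI sub size large)
    fix K :: real and A
    assume K: "K \<ge> 1" and A: "A \<subseteq> carrier G"
      and doubling: "real (card (A <#>\<^bsub>G\<^esub> A)) \<le> K * real (card A)"
      and card: "real (card A) = \<alpha> * real (order G)"
    show "\<exists>F\<in>\<F> (LEAST l. popular_level G ?c \<alpha> A (log 2 K) l). F \<subseteq> A <#>\<^bsub>G\<^esub> A \<and>
        level_set G \<alpha> A (LEAST l. popular_level G ?c \<alpha> A (log 2 K) l) \<subseteq> F"
      if "\<exists>l. popular_level G ?c \<alpha> A (log 2 K) l"
      by (rule cover[OF A card LeastI_ex[OF that]])
    show ex: "\<exists>l. popular_level G ?c \<alpha> A (of_int \<lceil>log 2 K\<rceil>) l"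
      by (rule popular_level_exists[OF fin \<alpha>(1) K A doubling card])
    show "\<exists>F\<in>\<F> (LEAST l. popular_level G ?c \<alpha> A (of_int \<lceil>log 2 K\<rceil>) l). F \<subseteq> A <#>\<^bsub>G\<^esub> A \<and>
        level_set G \<alpha> A (LEAST l. popular_level G ?c \<alpha> A (of_int \<lceil>log 2 K\<rceil>) l) \<subseteq> F"
      by (rule cover[OF A card LeastI_ex[OF ex]])
  qed
qed auto

end
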